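(* Let $G$ be a compact Hausdorff topological group with Haar measure $\lambda$ and Solecki submeasure $\sigma$. Then every subset $A\subset G$ satisfies $$\max\{\lambda_*(A),\lambda(A^\bullet)\}\le\sigma(A)\le\lambda(\bar A).$$
   Context: A finitely supported probability measure on a group $G$ is a convex combination $\mu=\sum_{i=1}^n\alpha_i\delta_{x_i}$ of Dirac measures ($\delta_x(B)=1$ if $x\in B$ and $0$ otherwise), defined on all subsets of $G$; $P_\omega(G)$ is the set of all such measures. The Solecki submeasure of a subset $A$ of $G$ is $\sigma(A)=\inf_{\mu\in P_\omega(G)}\sup_{x,y\in G}\mu(xAy)$. The Haar measure $\lambda$ on a compact Hausdorff topological group $G$ is the unique invariant regular $\sigma$-additive Borel probability measure on $G$. For $A\subset G$: $\lambda_*(A)=\sup\{\lambda(F):F\subset A,\ F\text{ closed in }G\}$; $\bar A$ is the closure of $A$ in $G$; and $A^\bullet$ (the comeager interior) is the largest open set in $G$ such that $A^\bullet\setminus A$ is meager in $G$. *)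

theory Defs
  imports "HOL-Probability.Probability"
begin

text \<open>
  Groups are written additively, following the library class \<^class>\<open>topological_group_add\<close>; the class
  \<^class>\<open>group_add\<close> does not assume commutativity. So the product \<open>x A y\<close> reads \<open>x + A + y\<close>.
\<close>

definition two_sided_translate :: "'a::group_add \<Rightarrow> 'a set \<Rightarrow> 'a \<Rightarrow> 'a set" where
  "two_sided_translate x A y = (\<lambda>a. x + a + y) ` A"

definition dirac :: "'a \<Rightarrow> 'a set \<Rightarrow> real" where
  "dirac x B = (if x \<in> B then 1 else 0)"

definition fin_supp_prob_measures :: "('a set \<Rightarrow> real) set" where
  "fin_supp_prob_measures =
     {\<mu>. \<exists>(n::nat) (\<alpha> :: nat \<Rightarrow> real) (x :: nat \<Rightarrow> 'a).
          (\<forall>i<n. 0 \<le> \<alpha> i) \<and> (\<Sum>i<n. \<alpha> i) = 1 \<and> \<mu> = (\<lambda>B. \<Sum>i<n. \<alpha> i * dirac (x i) B)}"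

text \<open>
  All values lie in \<open>[0, 1]\<close> and the index sets are nonempty, so the real infimum and supremum here
  (and the supremum in \<open>lower_measure\<close> below) are the genuine ones.
\<close>

definition solecki :: "'a::group_add set \<Rightarrow> real" where
  "solecki A = (INF \<mu>\<in>fin_supp_prob_measures. SUP (x, y)\<in>UNIV. \<mu> (two_sided_translate x A y))"

text \<open>
  On a compact Hausdorff group there is exactly one measure satisfying the following predicate.
  Invariance is two-sided. Regularity is approximation of Borel sets by closed sets from inside and
  by open sets from outside.
\<close>

definition haar_measure :: "'a::topological_group_add measure \<Rightarrow> bool" where
  "haar_measure M \<longleftrightarrow>
     prob_space M \<and> sets M = sets borel \<and>
     (\<forall>B\<in>sets borel. \<forall>x y. emeasure M (two_sided_translate x B y) = emeasure M B) \<and>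
     (\<forall>B\<in>sets borel. \<forall>e>0. \<exists>F U. closed F \<and> open U \<and> F \<subseteq> B \<and> B \<subseteq> U \<and> measure M (U - F) < e)"

definition lower_measure :: "'a::topological_space measure \<Rightarrow> 'a set \<Rightarrow> real" where
  "lower_measure M A = (SUP F\<in>{F. closed F \<and> F \<subseteq> A}. measure M F)"

definition nowhere_dense :: "'a::topological_space set \<Rightarrow> bool" where
  "nowhere_dense N \<longleftrightarrow> interior (closure N) = {}"

definition meager :: "'a::topological_space set \<Rightarrow> bool" where
  "meager A \<longleftrightarrow> (\<exists>\<N>. countable \<N> \<and> (\<forall>N\<in>\<N>. nowhere_dense N) \<and> A = \<Union>\<N>)"

text \<open>
  The greatest element is taken with respect to inclusion; it exists in every topological space by
  the Banach category theorem (a union of meager open sets is meager).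
\<close>

definition comeager_interior :: "'a::topological_space set \<Rightarrow> 'a set" where
  "comeager_interior A = (GREATEST U. open U \<and> meager (U - A))"

end

theory Submission
  imports Defs
begin

text \<open>
  Both lower bounds come from averaging. For \<open>\<mu> = (\<Sum>i. \<alpha> i * \<delta>\<^bsub>x i\<^esub>)\<close> and a Borel set \<open>B\<close>, the
  function \<open>u \<mapsto> \<mu> (-u + B) = (\<Sum>i. \<alpha> i * indicator B (u + x i))\<close> has Haar mean \<open>\<lambda> B\<close>, because right
  translations preserve \<open>\<lambda>\<close>. Some value is therefore at least \<open>\<lambda> B\<close>. So \<open>\<lambda> B \<le> \<sigma> A\<close> as soon as
  every finite configuration of points that has a left translate inside \<open>B\<close> also has one inside \<open>A\<close>
  (lemma \<open>measure_le_solecki\<close>). For a closed \<open>B \<subseteq> A\<close> this is trivial. For \<open>B\<close> the comeager interior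
  of \<open>A\<close>, the translations that move the configuration into the open set \<open>B\<close> form a nonempty open
  set, while those that move some point of it into \<open>B - A\<close> form a meager set; by the Baire category
  theorem some translation of the first kind is not of the second (lemma
  \<open>finite_configuration_into_comeager\<close>). This needs \<open>B - A\<close> to be meager for the largest such open
  set, which is the Banach category theorem (lemma \<open>meager_Union_Diff\<close>).

  The upper bound comes from discretising \<open>\<lambda>\<close>. Take an open \<open>U\<close> around the closure \<open>K\<close> of \<open>A\<close>
  whose measure is close to that of \<open>K\<close>. By compactness some neighbourhood \<open>W\<close> of \<open>0\<close> satisfies
  \<open>W + x + K + y \<subseteq> x + U + y\<close> for all \<open>x\<close> and \<open>y\<close> at once (lemma \<open>uniform_neighbourhood\<close>). Cover the
  group by finitely many translates \<open>W + g i\<close>, refine the cover to a Borel partition, and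
  concentrate the mass of each piece at the point \<open>g i\<close>. The resulting \<open>\<mu>\<close> gives every translate of
  \<open>K\<close> at most the Haar measure of the same translate of \<open>U\<close>, that is \<open>\<lambda> U\<close>.
\<close>

section \<open>Meager sets and the Banach category theorem\<close>

lemma nowhere_dense_iff:
  "nowhere_dense N \<longleftrightarrow> (\<forall>P. open P \<and> P \<noteq> {} \<longrightarrow> (\<exists>Q. open Q \<and> Q \<noteq> {} \<and> Q \<subseteq> P \<and> Q \<inter> N = {}))"
proof
  assume N: "nowhere_dense N"
  show "\<forall>P. open P \<and> P \<noteq> {} \<longrightarrow> (\<exists>Q. open Q \<and> Q \<noteq> {} \<and> Q \<subseteq> P \<and> Q \<inter> N = {})"
  proof (intro allI impI)
    fix P :: "'a set"
    assume P: "open P \<and> P \<noteq> {}"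
    then have "\<not> P \<subseteq> closure N"
      using N interior_maximal[of P "closure N"] by (auto simp: nowhere_dense_def)
    then show "\<exists>Q. open Q \<and> Q \<noteq> {} \<and> Q \<subseteq> P \<and> Q \<inter> N = {}"
      using P closure_subset[of N] by (intro exI[of _ "P - closure N"]) auto
  qed
next
  assume *: "\<forall>P. open P \<and> P \<noteq> {} \<longrightarrow> (\<exists>Q. open Q \<and> Q \<noteq> {} \<and> Q \<subseteq> P \<and> Q \<inter> N = {})"
  show "nowhere_dense N"
    unfolding nowhere_dense_def
  proof (rule ccontr)
    assume "interior (closure N) \<noteq> {}"
    then obtain Q where Q: "open Q" "Q \<noteq> {}" "Q \<subseteq> interior (closure N)" "Q \<inter> N = {}"
      using * open_interior by meson
    then have "Q \<inter> closure N = {}"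
      by (simp add: open_Int_closure_eq_empty)
    then show False
      using Q interior_subset[of "closure N"] by blast
  qed
qed

lemma nowhere_dense_subset: "nowhere_dense N \<Longrightarrow> N' \<subseteq> N \<Longrightarrow> nowhere_dense N'"
  unfolding nowhere_dense_def by (metis closure_mono interior_mono subset_empty)

lemma meager_iff_sequence:
  "meager A \<longleftrightarrow> (\<exists>N :: nat \<Rightarrow> 'a set. (\<forall>n. nowhere_dense (N n)) \<and> A \<subseteq> (\<Union>n. N n))"
  for A :: "'a::topological_space set"
proof
  assume "meager A"
  then obtain \<N> where \<N>: "countable \<N>" "\<forall>N\<in>\<N>. nowhere_dense N" "A = \<Union>\<N>"
    by (auto simp: meager_def)
  \<comment> \<open>The family may be empty, so the empty set is added before enumerating it.\<close>
  define N where "N = from_nat_into (insert {} \<N>)"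
  have range_N: "range N = insert {} \<N>"
    unfolding N_def using \<N>(1) by (intro range_from_nat_into) auto
  have "nowhere_dense (N n)" for n
  proof -
    have "N n \<in> insert {} \<N>"
      using range_N by blast
    then show ?thesis
      using \<N>(2) by (auto simp: nowhere_dense_def)
  qed
  then show "\<exists>N :: nat \<Rightarrow> 'a set. (\<forall>n. nowhere_dense (N n)) \<and> A \<subseteq> (\<Union>n. N n)"
    using range_N \<N>(3) by (intro exI[of _ N]) auto
next
  assume "\<exists>N :: nat \<Rightarrow> 'a set. (\<forall>n. nowhere_dense (N n)) \<and> A \<subseteq> (\<Union>n. N n)"
  then obtain N :: "nat \<Rightarrow> 'a set" where "\<forall>n. nowhere_dense (N n)" "A \<subseteq> (\<Union>n. N n)"
    by blast
  then show "meager A"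
    unfolding meager_def
    by (intro exI[of _ "range (\<lambda>n. A \<inter> N n)"])
      (auto intro: nowhere_dense_subset[OF _ Int_lower2])
qed

lemma meager_subset: "meager A \<Longrightarrow> B \<subseteq> A \<Longrightarrow> meager B"
  unfolding meager_iff_sequence by blast

lemma meager_UN_countable:
  assumes "countable I" "\<And>i. i \<in> I \<Longrightarrow> meager (A i)"
  shows "meager (\<Union>i\<in>I. A i)"
proof -
  obtain \<N> where \<N>: "\<And>i. i \<in> I \<Longrightarrow> countable (\<N> i) \<and> (\<forall>N\<in>\<N> i. nowhere_dense N) \<and> A i = \<Union>(\<N> i)"
    using assms(2) unfolding meager_def by metis
  then show ?thesis
    unfolding meager_def using assms(1)
    by (intro exI[of _ "\<Union>i\<in>I. \<N> i"]) auto
qed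

lemma nowhere_dense_imp_meager: "nowhere_dense N \<Longrightarrow> meager N"
  unfolding meager_iff_sequence by (intro exI[of _ "\<lambda>_. N"]) auto

lemma meager_Un: "meager A \<Longrightarrow> meager B \<Longrightarrow> meager (A \<union> B)"
  using meager_UN_countable[of "{A, B}" "\<lambda>S. S"] by auto

text \<open>
  The key to the Banach category theorem: inside one member of a disjoint open family only the
  corresponding piece of the union is visible, so nowhere dense pieces, however many, do not add up.
\<close>
lemma nowhere_dense_UN_disjoint_open:
  assumes disj: "pairwise disjnt \<V>" and op: "\<And>V. V \<in> \<V> \<Longrightarrow> open V"
    and N: "\<And>V. V \<in> \<V> \<Longrightarrow> nowhere_dense (N V) \<and> N V \<subseteq> V"
  shows "nowhere_dense (\<Union>V\<in>\<V>. N V)"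
  unfolding nowhere_dense_iff
proof (intro allI impI, elim conjE)
  fix P :: "'a set"
  assume P: "open P" "P \<noteq> {}"
  show "\<exists>Q. open Q \<and> Q \<noteq> {} \<and> Q \<subseteq> P \<and> Q \<inter> (\<Union>V\<in>\<V>. N V) = {}"
  proof (cases "\<exists>V\<in>\<V>. P \<inter> V \<noteq> {}")
    case True
    then obtain V where V: "V \<in> \<V>" "P \<inter> V \<noteq> {}"
      by blast
    then obtain Q where Q: "open Q" "Q \<noteq> {}" "Q \<subseteq> P \<inter> V" "Q \<inter> N V = {}"
      using N[OF V(1)] P op[OF V(1)] unfolding nowhere_dense_iff by (meson open_Int)
    have "Q \<inter> N V' = {}" if "V' \<in> \<V>" for V'
    proof (cases "V' = V")
      case False
      then have "disjnt V' V"
        using disj V that by (auto simp: pairwise_def)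
      then show ?thesis
        using N[OF that] Q by (auto simp: disjnt_def)
    qed (use Q in simp)
    then show ?thesis
      using Q by blast
  next
    case False
    then show ?thesis
      using N P by blast
  qed
qed

lemma nowhere_dense_boundary_open:
  assumes "open V"
  shows "nowhere_dense (closure V - V)"
  unfolding nowhere_dense_iff
proof (intro allI impI, elim conjE)
  fix P :: "'a set"
  assume P: "open P" "P \<noteq> {}"
  show "\<exists>Q. open Q \<and> Q \<noteq> {} \<and> Q \<subseteq> P \<and> Q \<inter> (closure V - V) = {}"
  proof (cases "P \<inter> V = {}")
    case True
    then have "P \<inter> closure V = {}"
      using P by (simp add: open_Int_closure_eq_empty)
    then show ?thesis
      using P by blast
  next
    case False
    then show ?thesis
      using P assms by (intro exI[of _ "P \<inter> V"]) auto
  qed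
qed

text \<open>
  The Banach category theorem, relative to a set \<open>A\<close>. A maximal disjoint family of open sets, each
  inside a member of \<open>\<U>\<close>, has a union that is dense in \<open>\<Union>\<U>\<close>; the boundary of that union is
  nowhere dense, and inside it the \<open>n\<close>-th pieces of all members can be collected into one nowhere
  dense set.
\<close>
lemma meager_Union_Diff:
  fixes \<U> :: "'a::topological_space set set"
  assumes \<U>: "\<And>U. U \<in> \<U> \<Longrightarrow> open U \<and> meager (U - A)"
  shows "meager (\<Union>\<U> - A)"
proof -
  define \<P> where "\<P> = {\<V>. pairwise disjnt \<V> \<and> (\<forall>V\<in>\<V>. open V \<and> (\<exists>U\<in>\<U>. V \<subseteq> U))}"
  have "{} \<in> \<P>"
    by (auto simp: \<P>_def)
  moreover have "\<Union>\<C> \<in> \<P>" if "subset.chain \<P> \<C>" for \<C>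
    using that pairwise_chain_Union[of \<C> disjnt]
    unfolding \<P>_def subset_chain_def chain_subset_def by blast
  ultimately obtain \<V> where \<V>: "\<V> \<in> \<P>" and max: "\<And>X. X \<in> \<P> \<Longrightarrow> \<V> \<subseteq> X \<Longrightarrow> X = \<V>"
    using subset_Zorn_nonempty[of \<P>] by (metis empty_iff)
  have disj: "pairwise disjnt \<V>" and op: "\<And>V. V \<in> \<V> \<Longrightarrow> open V"
    and sub: "\<And>V. V \<in> \<V> \<Longrightarrow> \<exists>U\<in>\<U>. V \<subseteq> U"
    using \<V> by (auto simp: \<P>_def)
  have dense: "U \<subseteq> closure (\<Union>\<V>)" if "U \<in> \<U>" for U
  proof -
    define V where "V = U - closure (\<Union>\<V>)"
    have apart: "V \<inter> \<Union>\<V> = {}"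
      using closure_subset[of "\<Union>\<V>"] by (auto simp: V_def)
    have "insert V \<V> \<in> \<P>"
      using \<V> \<U>[OF that] that apart
      by (auto simp: \<P>_def pairwise_insert disjnt_def V_def)
    then have "V \<in> \<V>"
      using max[of "insert V \<V>"] by blast
    then have "V = {}"
      using apart by blast
    then show ?thesis
      by (simp add: V_def)
  qed
  have "meager (V - A)" if "V \<in> \<V>" for V
    using sub[OF that] \<U> meager_subset by (metis Diff_mono order_refl)
  then have "\<forall>V\<in>\<V>. \<exists>N :: nat \<Rightarrow> 'a set. (\<forall>n. nowhere_dense (N n)) \<and> V - A \<subseteq> (\<Union>n. N n)"
    unfolding meager_iff_sequence by blast
  then obtain N :: "'a set \<Rightarrow> nat \<Rightarrow> 'a set" where
    N: "\<forall>V\<in>\<V>. (\<forall>n. nowhere_dense (N V n)) \<and> V - A \<subseteq> (\<Union>n. N V n)"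
    by metis
  have "nowhere_dense (V \<inter> N V n)" if "V \<in> \<V>" for V n
    using N that by (auto intro: nowhere_dense_subset[OF _ Int_lower2])
  then have "nowhere_dense (\<Union>V\<in>\<V>. V \<inter> N V n)" for n
    by (intro nowhere_dense_UN_disjoint_open[OF disj op]) auto
  moreover have "\<Union>\<V> - A \<subseteq> (\<Union>n. \<Union>V\<in>\<V>. V \<inter> N V n)"
  proof
    fix x
    assume "x \<in> \<Union>\<V> - A"
    then obtain V where V: "V \<in> \<V>" "x \<in> V" "x \<in> V - A"
      by blast
    then have "x \<in> (\<Union>n. N V n)"
      using N by (metis subsetD)
    then show "x \<in> (\<Union>n. \<Union>V\<in>\<V>. V \<inter> N V n)"
      using V by auto
  qed
  ultimately have "meager (\<Union>\<V> - A)"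
    unfolding meager_iff_sequence by (intro exI[of _ "\<lambda>n. \<Union>V\<in>\<V>. V \<inter> N V n"]) auto
  moreover have "meager (closure (\<Union>\<V>) - \<Union>\<V>)"
    using op by (intro nowhere_dense_imp_meager nowhere_dense_boundary_open) auto
  ultimately have "meager ((\<Union>\<V> - A) \<union> (closure (\<Union>\<V>) - \<Union>\<V>))"
    by (rule meager_Un)
  then show ?thesis
    by (rule meager_subset) (use dense in blast)
qed

lemma comeager_interior:
  shows open_comeager_interior: "open (comeager_interior A)"
    and meager_comeager_interior_Diff: "meager (comeager_interior A - A)"
proof -
  define W where "W = \<Union>{U. open U \<and> meager (U - A)}"
  have W: "open W \<and> meager (W - A)"
    unfolding W_def by (intro conjI open_Union meager_Union_Diff) auto
  have "comeager_interior A = W"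
    unfolding comeager_interior_def by (rule Greatest_equality) (use W in \<open>auto simp: W_def\<close>)
  then show "open (comeager_interior A)" "meager (comeager_interior A - A)"
    using W by auto
qed

lemma Baire_compact_Hausdorff:
  fixes U :: "'a::t2_space set"
  assumes "compact (UNIV :: 'a set)" "open U" "U \<noteq> {}" "meager N"
  shows "\<not> U \<subseteq> N"
proof
  assume "U \<subseteq> N"
  obtain \<N> where \<N>: "countable \<N>" "\<forall>N\<in>\<N>. nowhere_dense N" "N = \<Union>\<N>"
    using assms(4) by (auto simp: meager_def)
  have "compact_space (euclidean :: 'a topology)"
    using assms(1) by (simp add: compact_space_def)
  moreover have "Hausdorff_space (euclidean :: 'a topology)"
    by (simp add: Hausdorff_space_def disjnt_def separation_t2)
  ultimately have "regular_space (euclidean :: 'a topology)"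
    by (rule compact_Hausdorff_imp_regular_space)
  then have "euclidean interior_of \<Union>(closure ` \<N>) = {}"
    using \<N> \<open>compact_space euclidean\<close> by (intro Baire_category_alt)
      (auto simp: nowhere_dense_def compact_imp_locally_compact_space)
  moreover have "U \<subseteq> \<Union>(closure ` \<N>)"
    using \<open>U \<subseteq> N\<close> \<N>(3) closure_subset by blast
  ultimately show False
    using assms(2,3) interior_maximal[of U] by auto
qed

lemma meager_vimage:
  fixes f :: "'a::topological_space \<Rightarrow> 'b::topological_space"
  assumes f: "continuous_on UNIV f" and "\<And>S. open S \<Longrightarrow> open (f ` S)" and "meager N"
  shows "meager (f -` N)"
proof -
  have nd: "nowhere_dense (f -` N)" if N: "nowhere_dense N" for N
    unfolding nowhere_dense_iff
  proof (intro allI impI, elim conjE)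
    fix P :: "'a set"
    assume P: "open P" "P \<noteq> {}"
    then obtain Q where Q: "open Q" "Q \<noteq> {}" "Q \<subseteq> f ` P" "Q \<inter> N = {}"
      using N assms(2)[of P] unfolding nowhere_dense_iff by (metis image_is_empty)
    have "open (f -` Q)"
      using f Q(1) by (simp add: open_vimage)
    then show "\<exists>Q. open Q \<and> Q \<noteq> {} \<and> Q \<subseteq> P \<and> Q \<inter> f -` N = {}"
      using Q P by (intro exI[of _ "P \<inter> f -` Q"]) auto
  qed
  obtain N' :: "nat \<Rightarrow> 'b set" where "\<forall>n. nowhere_dense (N' n)" "N \<subseteq> (\<Union>n. N' n)"
    using assms(3) unfolding meager_iff_sequence by blast
  then show ?thesis
    using nd unfolding meager_iff_sequence by (intro exI[of _ "\<lambda>n. f -` N' n"]) (metis vimage_UN vimage_mono)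
qed

section \<open>The Solecki submeasure as an infimum of suprema\<close>

lemma mem_two_sided_translate: "z \<in> two_sided_translate x A y \<longleftrightarrow> - x + z - y \<in> A"
proof
  assume "- x + z - y \<in> A"
  then have "x + (- x + z - y) + y \<in> two_sided_translate x A y"
    unfolding two_sided_translate_def by blast
  then show "z \<in> two_sided_translate x A y"
    by (simp add: add_diff_eq add.assoc[symmetric])
qed (auto simp: two_sided_translate_def add.assoc add_diff_eq[symmetric])

lemma fin_supp_prob_measure_bounds:
  assumes "\<mu> \<in> fin_supp_prob_measures"
  shows "0 \<le> \<mu> B" "\<mu> B \<le> 1"
proof -
  obtain n \<alpha> x where \<alpha>: "\<forall>i<n. 0 \<le> \<alpha> i" "(\<Sum>i<n. \<alpha> i) = 1"
    and \<mu>: "\<mu> = (\<lambda>B. \<Sum>i<n::nat. \<alpha> i * dirac (x i) B)"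
    using assms unfolding fin_supp_prob_measures_def by blast
  show "0 \<le> \<mu> B"
    using \<alpha> by (auto simp: \<mu> dirac_def intro!: sum_nonneg)
  have "\<mu> B \<le> (\<Sum>i<n. \<alpha> i)"
    unfolding \<mu> using \<alpha>(1) by (intro sum_mono) (auto simp: dirac_def)
  then show "\<mu> B \<le> 1"
    using \<alpha> by simp
qed

lemma bdd_above_translates:
  assumes "\<mu> \<in> fin_supp_prob_measures"
  shows "bdd_above (range (\<lambda>(x, y). \<mu> (two_sided_translate x A y)))"
  by (rule bdd_aboveI2[where M = 1])
    (simp add: split_beta fin_supp_prob_measure_bounds(2)[OF assms])

lemma solecki_leI:
  assumes \<mu>: "\<mu> \<in> fin_supp_prob_measures" and le: "\<And>x y. \<mu> (two_sided_translate x A y) \<le> c"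
  shows "solecki A \<le> c"
  unfolding solecki_def
proof (rule cINF_lower2[OF _ \<mu>])
  show "(SUP (x, y)\<in>UNIV. \<mu> (two_sided_translate x A y)) \<le> c"
    by (rule cSUP_least) (use le in auto)
  have "0 \<le> (SUP (x, y)\<in>UNIV. \<nu> (two_sided_translate x A y))"
    if "\<nu> \<in> fin_supp_prob_measures" for \<nu>
    using fin_supp_prob_measure_bounds(1)[OF that]
    by (intro cSUP_upper2[OF bdd_above_translates[OF that], of "(0, 0)"]) auto
  then show "bdd_below
    ((\<lambda>\<mu>. SUP (x, y)\<in>UNIV. \<mu> (two_sided_translate x A y)) ` fin_supp_prob_measures)"
    by (rule bdd_belowI2)
qed

lemma le_soleckiI:
  assumes "\<And>\<mu>. \<mu> \<in> fin_supp_prob_measures \<Longrightarrow> \<exists>x y. c \<le> \<mu> (two_sided_translate x A y)"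
  shows "c \<le> solecki A"
  unfolding solecki_def
proof (rule cINF_greatest)
  have "(\<lambda>B. \<Sum>i<1::nat. 1 * dirac (0::'a) B) \<in> fin_supp_prob_measures"
    unfolding fin_supp_prob_measures_def
    by (intro CollectI exI[of _ 1] exI[of _ "\<lambda>_. 1"] exI[of _ "\<lambda>_. 0"]) auto
  then show "(fin_supp_prob_measures :: ('a set \<Rightarrow> real) set) \<noteq> {}"
    by blast
  fix \<mu> :: "'a set \<Rightarrow> real"
  assume \<mu>: "\<mu> \<in> fin_supp_prob_measures"
  obtain x y where "c \<le> \<mu> (two_sided_translate x A y)"
    using assms[OF \<mu>] by blast
  then show "c \<le> (SUP (x, y)\<in>UNIV. \<mu> (two_sided_translate x A y))"
    by (intro cSUP_upper2[OF bdd_above_translates[OF \<mu>], of "(x, y)"]) auto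
qed

section \<open>Lower bounds by averaging over translations\<close>

lemma haar_right_translate:
  assumes "haar_measure M" "B \<in> sets borel"
  shows "(\<lambda>u. u + x) -` B \<in> sets M" "measure M ((\<lambda>u. u + x) -` B) = measure M B"
proof -
  have eq: "(\<lambda>u. u + x) -` B = two_sided_translate 0 B (- x)"
    by (auto simp: mem_two_sided_translate)
  have "emeasure M (two_sided_translate 0 B (- x)) = emeasure M B"
    using assms unfolding haar_measure_def by blast
  then show "measure M ((\<lambda>u. u + x) -` B) = measure M B"
    by (simp add: eq measure_def)
  have "(\<lambda>u. u + x) \<in> borel_measurable borel"
    by (intro borel_measurable_continuous_onI continuous_intros)
  from measurable_sets[OF this assms(2)] show "(\<lambda>u. u + x) -` B \<in> sets M"
    using assms(1) by (simp add: haar_measure_def)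
qed

text \<open>
  The right-hand side, as a function of \<open>u\<close>, has mean \<open>measure M B\<close>, so it is not everywhere smaller.
\<close>
lemma average_over_translations:
  fixes M :: "'a::topological_group_add measure" and \<alpha> :: "nat \<Rightarrow> real"
  assumes haar: "haar_measure M" and B: "B \<in> sets borel" and \<alpha>: "(\<Sum>i<n. \<alpha> i) = 1"
  shows "\<exists>u. measure M B \<le> (\<Sum>i<n. \<alpha> i * indicator B (u + x i))"
proof (rule ccontr)
  interpret prob_space M
    using haar by (simp add: haar_measure_def)
  define f where "f u = (\<Sum>i<n. \<alpha> i * indicator ((\<lambda>u. u + x i) -` B) u)" for u
  have int: "integrable M (\<lambda>u. \<alpha> i * indicator ((\<lambda>u. u + x i) -` B) u)" for i
    using haar_right_translate(1)[OF haar B] by (auto simp: emeasure_eq_measure)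
  assume "\<nexists>u. measure M B \<le> (\<Sum>i<n. \<alpha> i * indicator B (u + x i))"
  then have "f u < measure M B" for u
    by (auto simp: f_def indicator_def not_le)
  then have "expectation f < measure M B"
    using int unfolding f_def by (intro expectation_less Bochner_Integration.integrable_sum) auto
  moreover have "expectation f = (\<Sum>i<n. \<alpha> i * measure M B)"
    unfolding f_def using int haar_right_translate[OF haar B]
    by (subst Bochner_Integration.integral_sum) (auto simp: sets.sets_into_space Int_absorb2)
  ultimately show False
    using \<alpha> by (simp add: sum_distrib_right[symmetric])
qed

text \<open>
  Only the finite configurations that translate into \<open>B\<close> matter: some translate of the support of \<open>\<mu>\<close>
  meets \<open>B\<close> in mass at least \<open>measure M B\<close>, and the part inside \<open>B\<close> can be moved into \<open>A\<close>.
\<close>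
lemma measure_le_solecki:
  fixes M :: "'a::topological_group_add measure"
  assumes haar: "haar_measure M" and B: "B \<in> sets borel"
    and move: "\<And>(I :: nat set) x u. finite I \<Longrightarrow> (\<And>i. i \<in> I \<Longrightarrow> u + x i \<in> B)
                 \<Longrightarrow> \<exists>v. \<forall>i\<in>I. v + x i \<in> A"
  shows "measure M B \<le> solecki A"
proof (rule le_soleckiI)
  fix \<mu> :: "'a set \<Rightarrow> real"
  assume "\<mu> \<in> fin_supp_prob_measures"
  then obtain n \<alpha> x where \<alpha>: "\<forall>i<n. 0 \<le> \<alpha> i" "(\<Sum>i<n. \<alpha> i) = 1"
    and \<mu>: "\<mu> = (\<lambda>B. \<Sum>i<n::nat. \<alpha> i * dirac (x i) B)"
    unfolding fin_supp_prob_measures_def by blast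
  obtain u where u: "measure M B \<le> (\<Sum>i<n. \<alpha> i * indicator B (u + x i))"
    using average_over_translations[OF haar B \<alpha>(2)] by blast
  have "\<exists>v. \<forall>i\<in>{i. i < n \<and> u + x i \<in> B}. v + x i \<in> A"
    by (rule move[where u = u]) auto
  then obtain v where v: "\<And>i. i < n \<Longrightarrow> u + x i \<in> B \<Longrightarrow> v + x i \<in> A"
    by blast
  have "(\<Sum>i<n. \<alpha> i * indicator B (u + x i)) \<le> \<mu> (two_sided_translate (- v) A 0)"
    unfolding \<mu> using \<alpha> v
    by (intro sum_mono mult_left_mono)
      (auto simp: dirac_def indicator_def mem_two_sided_translate)
  then show "\<exists>a b. measure M B \<le> \<mu> (two_sided_translate a A b)"
    using u by (meson order_trans)
qed

text \<open>
  The good translations, those moving every point into \<open>U\<close>, form an open set \<open>P\<close> containing \<open>u\<close>; the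
  bad ones, moving some point into \<open>U - A\<close>, form a finite union of preimages of a meager set under
  homeomorphisms. Baire's theorem gives a good translation that is not bad.
\<close>
lemma finite_configuration_into_comeager:
  fixes A U :: "'a::{topological_group_add, t2_space} set"
  assumes comp: "compact (UNIV :: 'a set)" and U: "open U" "meager (U - A)"
    and "finite I" and u: "\<And>i. i \<in> I \<Longrightarrow> u + x i \<in> U"
  shows "\<exists>v. \<forall>i\<in>I. v + x i \<in> A"
proof -
  define P where "P = (\<Inter>i\<in>I. (\<lambda>v. v + x i) -` U)"
  have cont: "continuous_on UNIV (\<lambda>v. v + a)" for a :: 'a
    by (intro continuous_intros)
  have vim: "open ((\<lambda>v. v + a) -` S)" if "open S" for S and a :: 'a
    using that cont by (rule open_vimage)
  have "open ((\<lambda>v. v + a) ` S)" if "open S" for S and a :: 'a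
  proof -
    have "(\<lambda>v. v + a) ` S = (\<lambda>v. v + - a) -` S"
      by (force simp: image_iff add.assoc)
    then show ?thesis
      using vim[OF that, of "- a"] by simp
  qed
  then have "meager (\<Union>i\<in>I. (\<lambda>v. v + x i) -` (U - A))"
    using \<open>finite I\<close> U(2) cont
    by (intro meager_UN_countable meager_vimage) (auto intro: countable_finite)
  moreover have "open P"
    using \<open>finite I\<close> U(1) vim by (auto simp: P_def)
  moreover have "u \<in> P"
    using u by (simp add: P_def)
  ultimately have "\<not> P \<subseteq> (\<Union>i\<in>I. (\<lambda>v. v + x i) -` (U - A))"
    by (intro Baire_compact_Hausdorff[OF comp]) auto
  then show ?thesis
    by (auto simp: P_def)
qed

section \<open>The upper bound by discretising Haar measure\<close>

text \<open>
  The set of all \<open>(w, x, k)\<close> with \<open>- x + w + x + k \<in> U\<close> is open and contains \<open>{0} \<times> UNIV \<times> K\<close>, so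
  the tube lemma yields \<open>W\<close>. Letting \<open>x\<close> range over the compact group makes \<open>W\<close> independent of the
  conjugation by \<open>x\<close>.
\<close>
lemma uniform_neighbourhood:
  fixes K U :: "'a::topological_group_add set"
  assumes comp: "compact (UNIV :: 'a set)" and "compact K" "open U" "K \<subseteq> U"
  obtains W where "open W" "0 \<in> W"
    "\<And>w g x y. w \<in> W \<Longrightarrow> g \<in> two_sided_translate x K y \<Longrightarrow> w + g \<in> two_sided_translate x U y"
proof -
  define T where "T = (\<lambda>(w, x, k). - x + w + x + k) -` U"
  have "open T"
    unfolding T_def split_beta
    by (intro open_vimage[OF \<open>open U\<close>] continuous_intros)
  moreover have "{0} \<times> (UNIV \<times> K) \<subseteq> T"
    using \<open>K \<subseteq> U\<close> by (auto simp: T_def)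
  ultimately obtain W where W: "0 \<in> W" "open W" "W \<times> (UNIV \<times> K) \<subseteq> T"
    using Elementary_Topology.tube_lemma[OF compact_Times[OF comp \<open>compact K\<close>]] by metis
  have "w + g \<in> two_sided_translate x U y" if "w \<in> W" "g \<in> two_sided_translate x K y" for w g x y
  proof -
    have "- x + w + x + (- x + g - y) \<in> U"
      using W(3) that by (force simp: T_def mem_two_sided_translate)
    then show ?thesis
      by (simp add: mem_two_sided_translate add.assoc add_diff_eq)
  qed
  then show ?thesis
    using that W by blast
qed

text \<open>
  A piece \<open>P i\<close> lies in \<open>W + g i\<close>, so whenever its atom \<open>g i\<close> falls into a translate of \<open>A\<close>, the whole
  piece falls into the same translate of \<open>U\<close>. The atoms in the translate of \<open>A\<close> thus carry no more mass
  than \<open>measure M U\<close>.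
\<close>
lemma solecki_le_measure_open:
  fixes M :: "'a::topological_group_add measure"
  assumes comp: "compact (UNIV :: 'a set)" and haar: "haar_measure M"
    and K: "compact K" "A \<subseteq> K" and U: "open U" "K \<subseteq> U"
  shows "solecki A \<le> measure M U"
proof -
  interpret prob_space M
    using haar by (simp add: haar_measure_def)
  have sets: "sets M = sets borel"
    using haar by (simp add: haar_measure_def)
  then have space: "space M = UNIV"
    using sets_eq_imp_space_eq[OF sets] by simp
  obtain W where W: "open W" "0 \<in> W"
    and WU: "\<And>w g x y. w \<in> W \<Longrightarrow> g \<in> two_sided_translate x K y
               \<Longrightarrow> w + g \<in> two_sided_translate x U y"
    using uniform_neighbourhood[OF comp K(1) U] by metis
  define C where "C g = (\<lambda>u. u + - g) -` W" for g
  have opC: "open (C g)" for g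
    unfolding C_def by (intro open_vimage[OF W(1)] continuous_intros)
  have "UNIV \<subseteq> (\<Union>g\<in>UNIV. C g)"
    using W(2) by (auto simp: C_def)
  then obtain F where F: "finite F" "UNIV \<subseteq> (\<Union>g\<in>F. C g)"
    using compactE_image[OF comp, of UNIV C] opC by metis
  obtain n :: nat and g :: "nat \<Rightarrow> 'a" where g: "F = g ` {..<n}"
    using finite_imp_nat_seg_image_inj_on[OF F(1)] by (auto simp: lessThan_def)
  define P where "P i = C (g i) - (\<Union>j<i. C (g j))" for i
  have P_disj: "disjoint_family_on P {..<n}"
    unfolding disjoint_family_on_def
  proof (intro ballI impI)
    show "P i \<inter> P j = {}" if "i \<noteq> j" for i j
      using that by (cases i j rule: linorder_cases) (auto simp: P_def)
  qed
  have P_sets [measurable]: "P i \<in> sets M" for i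
    unfolding sets P_def using opC by (intro sets.Diff sets.finite_UN) auto
  have "u \<in> (\<Union>i<n. P i)" for u
  proof -
    \<comment> \<open>the piece containing \<open>u\<close> has the least index among the cover members containing \<open>u\<close>\<close>
    define i where "i = (LEAST i. i < n \<and> u \<in> C (g i))"
    have "\<exists>i. i < n \<and> u \<in> C (g i)"
      using F(2) g by auto
    then have i: "i < n" "u \<in> C (g i)"
      using LeastI_ex[of "\<lambda>i. i < n \<and> u \<in> C (g i)"] by (auto simp: i_def)
    moreover have "u \<notin> C (g j)" if "j < i" for j
      using not_less_Least[of j "\<lambda>i. i < n \<and> u \<in> C (g i)"] that i(1) by (auto simp: i_def)
    ultimately show ?thesis
      by (auto simp: P_def)
  qed
  then have P_cover: "(\<Union>i<n. P i) = UNIV"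
    by blast
  define \<mu> where "\<mu> = (\<lambda>B. \<Sum>i<n. measure M (P i) * dirac (g i) B)"
  have "(\<Sum>i<n. measure M (P i)) = measure M (\<Union>i<n. P i)"
    using P_disj by (intro finite_measure_finite_Union[symmetric]) auto
  then have "(\<Sum>i<n. measure M (P i)) = 1"
    using P_cover space prob_space by simp
  then have "\<mu> \<in> fin_supp_prob_measures"
    unfolding fin_supp_prob_measures_def \<mu>_def
    by (intro CollectI exI[of _ n] exI[of _ "\<lambda>i. measure M (P i)"] exI[of _ g]) auto
  moreover have "\<mu> (two_sided_translate x A y) \<le> measure M U" for x y
  proof -
    define J where "J = {i. i < n \<and> g i \<in> two_sided_translate x A y}"
    have J: "finite J" "J \<subseteq> {..<n}"
      by (auto simp: J_def)
    have sub: "P i \<subseteq> two_sided_translate x U y" if "i \<in> J" for i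
    proof
      fix u
      assume "u \<in> P i"
      then have "u + - g i \<in> W"
        by (simp add: P_def C_def)
      moreover have "g i \<in> two_sided_translate x K y"
        using that K(2) by (auto simp: J_def mem_two_sided_translate)
      ultimately have "u + - g i + g i \<in> two_sided_translate x U y"
        by (rule WU)
      then show "u \<in> two_sided_translate x U y"
        by simp
    qed
    have "two_sided_translate x U y = (\<lambda>z. - x + z + - y) -` U"
      by (auto simp: mem_two_sided_translate)
    moreover have "open ((\<lambda>z. - x + z + - y) -` U)"
      by (intro open_vimage[OF U(1)] continuous_intros)
    ultimately have meas: "two_sided_translate x U y \<in> sets M"
      by (simp add: sets)
    have "\<mu> (two_sided_translate x A y) = (\<Sum>i\<in>J. measure M (P i))"
      unfolding \<mu>_def J_def
      by (rule sum.mono_neutral_cong_right) (auto simp: dirac_def)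
    also have "\<dots> = measure M (\<Union>i\<in>J. P i)"
      using J disjoint_family_on_mono[OF J(2) P_disj]
      by (intro finite_measure_finite_Union[symmetric]) auto
    also have "\<dots> \<le> measure M (two_sided_translate x U y)"
      using sub meas by (intro finite_measure_mono) auto
    also have "\<dots> = measure M U"
      using haar U(1) by (simp add: haar_measure_def measure_def)
    finally show ?thesis .
  qed
  ultimately show ?thesis
    by (rule solecki_leI)
qed

section \<open>Solecki submeasure versus Haar measure\<close>

theorem theorem11p1:
  fixes M :: "'a::{topological_group_add, t2_space} measure" and A :: "'a set"
  assumes "compact (UNIV :: 'a set)" and "haar_measure M"
  shows "max (lower_measure M A) (measure M (comeager_interior A)) \<le> solecki A
         \<and> solecki A \<le> measure M (closure A)"
proof (intro conjI max.boundedI)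
  show "lower_measure M A \<le> solecki A"
    unfolding lower_measure_def
  proof (rule cSUP_least)
    show "{F. closed F \<and> F \<subseteq> A} \<noteq> {}"
      by (auto intro: exI[of _ "{}"])
    show "measure M F \<le> solecki A" if "F \<in> {F. closed F \<and> F \<subseteq> A}" for F
      using that by (intro measure_le_solecki[OF assms(2)]) auto
  qed
  show "measure M (comeager_interior A) \<le> solecki A"
    using open_comeager_interior[of A]
      finite_configuration_into_comeager[OF assms(1) comeager_interior[of A]]
    by (intro measure_le_solecki[OF assms(2)]) auto
  show "solecki A \<le> measure M (closure A)"
  proof (rule field_le_epsilon)
    interpret prob_space M
      using assms(2) by (simp add: haar_measure_def)
    fix e :: real
    assume "e > 0"
    then obtain F U where FU: "closed F" "open U" "F \<subseteq> closure A" "closure A \<subseteq> U"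
      "measure M (U - F) < e"
      using assms(2) unfolding haar_measure_def by (metis borel_closed closed_closure)
    have sets: "sets M = sets borel"
      using assms(2) by (simp add: haar_measure_def)
    have "compact (closure A)"
      using compact_Int_closed[OF assms(1) closed_closure[of A]] by simp
    then have "solecki A \<le> measure M U"
      using FU closure_subset by (intro solecki_le_measure_open[OF assms]) auto
    also have "measure M U = measure M (U - F) + measure M F"
      using FU by (subst finite_measure_Diff) (auto simp: sets)
    also have "\<dots> \<le> measure M (closure A) + e"
      using FU finite_measure_mono[of F "closure A"] by (auto simp: sets)
    finally show "solecki A \<le> measure M (closure A) + e" .
  qed
qed

end
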